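(* Let $r$, $w$, $d$, and $t$ be positive integers with $w\le r$ and $t\ge r+w$. Then $$N((r,w;d),t)=bc_d(I_t(r,w)).$$
   Context: Write $[t]=\{1,\dots,t\}$. A set system $(X,\mathcal B)$ with $|X|=n$ and an indexed family of blocks $\mathcal B=\{B_1,\dots,B_t\}$ of subsets of $X$ is an $(r,w;d)-CFF(n,t)$ (cover-free family) if for all $L,M\subseteq[t]$ with $L\cap M=\varnothing$, $|L|=r$, $|M|=w$, we have $\left|\left(\bigcap_{l\in L}B_l\right)\setminus\left(\bigcup_{m\in M}B_m\right)\right|\ge d$. $N((r,w;d),t)$ denotes the minimum $n$ for which an $(r,w;d)-CFF(n,t)$ exists. For $0<w\le r\le t$, the bi-intersection graph $I_t(r,w)$ is the bipartite graph with one part consisting of all $r$-subsets of $[t]$ and the other part of all $w$-subsets of $[t]$ (two disjoint parts, even when $r=w$), where a $w$-subset is adjacent to an $r$-subset if and only if their intersection is empty. A biclique is a bipartite graph with vertex set $(X,Y)$ in which every vertex of $X$ is adjacent to every vertex of $Y$ (empty graphs count as bicliques). A $d$-biclique cover of a graph $G$ is a collection (multiset, repetitions allowed and counted with multiplicity) of bicliques of $G$ (i.e. subgraphs of $G$ that are bicliques) such that each edge of $G$ is in at least $d$ of them; $bc_d(G)$ is the minimum number of bicliques in a $d$-biclique cover of $G$. *)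

theory Defs
  imports
    "HOL-Library.Multiset"
    "Graph_Theory.Kuratowski"
begin

text \<open>
  The blocks are the family \<open>B 1, \<dots>, B t\<close>; repetitions are allowed, and the values of \<open>B\<close> outside
  \<open>{1..t}\<close> are irrelevant. Finiteness of the ground set is part of the definition because
  \<open>card\<close> is \<open>0\<close> on infinite sets.
\<close>

definition cover_free_family ::
    "nat \<Rightarrow> nat \<Rightarrow> nat \<Rightarrow> nat \<Rightarrow> nat \<Rightarrow> 'a set \<Rightarrow> (nat \<Rightarrow> 'a set) \<Rightarrow> bool" where
  "cover_free_family r w d n t X B \<longleftrightarrow>
     finite X \<and> card X = n \<and> (\<forall>i\<in>{1..t}. B i \<subseteq> X) \<and>
     (\<forall>L M. L \<subseteq> {1..t} \<longrightarrow> M \<subseteq> {1..t} \<longrightarrow> L \<inter> M = {} \<longrightarrow> card L = r \<longrightarrow> card M = w \<longrightarrow>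
        card ((\<Inter>l\<in>L. B l) - (\<Union>m\<in>M. B m)) \<ge> d)"

text \<open>
  Ground sets are taken inside \<^typ>\<open>nat\<close>, which loses nothing since they are finite
  (\<open>cover_free_family_transfer\<close> below).
\<close>

definition cff_number :: "nat \<Rightarrow> nat \<Rightarrow> nat \<Rightarrow> nat \<Rightarrow> nat" where
  "cff_number r w d t =
     (LEAST n. \<exists>(X :: nat set) B. cover_free_family r w d n t X B)"

text \<open>
  An undirected graph is a symmetric digraph, so each edge contributes two opposite arcs. The
  tags \<^const>\<open>Inl\<close> and \<^const>\<open>Inr\<close> keep the two parts disjoint also when \<open>r = w\<close>.
\<close>

definition bi_intersection_graph ::
    "nat \<Rightarrow> nat \<Rightarrow> nat \<Rightarrow> (nat set + nat set) pair_pre_digraph" where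
  "bi_intersection_graph t r w =
     \<lparr> pverts = Inl ` {A. A \<subseteq> {1..t} \<and> card A = r} \<union> Inr ` {B. B \<subseteq> {1..t} \<and> card B = w},
       parcs = (\<Union>A\<in>{A. A \<subseteq> {1..t} \<and> card A = r}.
                  \<Union>B\<in>{B. B \<subseteq> {1..t} \<and> card B = w \<and> A \<inter> B = {}}.
                    {(Inl A, Inr B), (Inr B, Inl A)}) \<rparr>"

text \<open>Either side of the complete bipartite graph may be empty.\<close>

definition biclique :: "('a, 'b) pre_digraph \<Rightarrow> bool" where
  "biclique H \<longleftrightarrow> (\<exists>m n. complete_bipartite_digraph m n H)"

text \<open>
  For a symmetric digraph \<open>G\<close>, a biclique of \<open>G\<close> contains an arc iff it contains the opposite
  arc, so counting covers of arcs is the same as counting covers of undirected edges.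
\<close>

definition d_biclique_cover ::
    "nat \<Rightarrow> ('a, 'b) pre_digraph \<Rightarrow> ('a, 'b) pre_digraph multiset \<Rightarrow> bool" where
  "d_biclique_cover d G C \<longleftrightarrow>
     (\<forall>H\<in>#C. subgraph H G \<and> biclique H) \<and>
     (\<forall>e\<in>arcs G. size {#H \<in># C. e \<in> arcs H#} \<ge> d)"

definition biclique_cover_number :: "nat \<Rightarrow> ('a, 'b) pre_digraph \<Rightarrow> nat" where
  "biclique_cover_number d G = (LEAST k. \<exists>C. d_biclique_cover d G C \<and> size C = k)"


lemma cover_free_family_transfer:
  assumes cff: "cover_free_family r w d n t X B" and r: "0 < r"
  shows "\<exists>(Y :: nat set) B'. cover_free_family r w d n t Y B'"
proof -
  have fin: "finite X" and n: "card X = n" and sub: "\<And>i. i \<in> {1..t} \<Longrightarrow> B i \<subseteq> X"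
    using cff by (auto simp: cover_free_family_def)
  obtain f :: "'a \<Rightarrow> nat" where f: "inj_on f X"
    using finite_imp_inj_to_nat_seg[OF fin] by blast
  have "card ((\<Inter>l\<in>L. f ` B l) - (\<Union>m\<in>M. f ` B m)) \<ge> d"
    if L: "L \<subseteq> {1..t}" and M: "M \<subseteq> {1..t}" and "L \<inter> M = {}" and cL: "card L = r" and "card M = w"
    for L M
  proof -
    let ?D = "(\<Inter>l\<in>L. B l) - (\<Union>m\<in>M. B m)"
    obtain l where l: "l \<in> L" using cL r by fastforce
    have BX: "B l \<subseteq> X" using l L sub by blast
    have DX: "?D \<subseteq> X" using l BX by blast
    have notin: "f x \<notin> f ` B m" if "x \<in> ?D" "m \<in> M" for x m
    proof
      assume "f x \<in> f ` B m"
      then obtain y where y: "f x = f y" "y \<in> B m" by blast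
      have "x \<in> X" using that(1) DX by (rule subsetD[rotated])
      moreover have "y \<in> X" using \<open>m \<in> M\<close> M sub y(2) by blast
      ultimately have "x = y" using f y(1) by (auto dest: inj_onD)
      with that y(2) show False by blast
    qed
    have "f ` ?D \<subseteq> (\<Inter>l\<in>L. f ` B l) - (\<Union>m\<in>M. f ` B m)"
    proof
      fix z assume "z \<in> f ` ?D"
      then obtain x where x: "x \<in> ?D" "z = f x" by (rule imageE)
      have "z \<in> f ` B l" if "l \<in> L" for l using x that by simp
      moreover have "z \<notin> f ` B m" if "m \<in> M" for m using notin[OF x(1) that] x(2) by simp
      ultimately show "z \<in> (\<Inter>l\<in>L. f ` B l) - (\<Union>m\<in>M. f ` B m)" by simp
    qed
    moreover have "finite ((\<Inter>l\<in>L. f ` B l) - (\<Union>m\<in>M. f ` B m))"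
    proof (rule finite_subset)
      show "(\<Inter>l\<in>L. f ` B l) - (\<Union>m\<in>M. f ` B m) \<subseteq> f ` B l"
        using l by (auto simp del: image_eqI)
      show "finite (f ` B l)" using BX fin finite_subset by blast
    qed
    ultimately have "card (f ` ?D) \<le> card ((\<Inter>l\<in>L. f ` B l) - (\<Union>m\<in>M. f ` B m))"
      by (rule card_mono[rotated])
    moreover have "card (f ` ?D) = card ?D"
      using f DX by (meson card_image inj_on_subset)
    moreover have "card ?D \<ge> d" using cff that unfolding cover_free_family_def by blast
    ultimately show ?thesis by linarith
  qed
  moreover have "\<forall>i\<in>{1..t}. f ` B i \<subseteq> f ` X" using sub by blast
  moreover have "card (f ` X) = n" using f n by (simp add: card_image)
  ultimately have "cover_free_family r w d n t (f ` X) (\<lambda>i. f ` B i)"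
    using fin by (simp add: cover_free_family_def)
  then show ?thesis by blast
qed

text \<open>
  The two minima above range over nonempty sets, for \<open>0 < r\<close> and for finite simple
  graphs respectively, hence are genuine minima.
\<close>

lemma cover_free_family_exists:
  assumes r: "0 < r"
  shows "\<exists>n (X :: nat set) B. cover_free_family r w d n t X B"
proof -
  let ?X = "Pow {1..t} \<times> {..<d}"
  let ?B = "\<lambda>i. {p \<in> ?X. i \<in> fst p}"
  have "card ((\<Inter>l\<in>L. ?B l) - (\<Union>m\<in>M. ?B m)) \<ge> d"
    if L: "L \<subseteq> {1..t}" and "L \<inter> M = {}" and cL: "card L = r" for L M
  proof -
    have "L \<noteq> {}" using cL r by auto
    have "{L} \<times> {..<d} \<subseteq> (\<Inter>l\<in>L. ?B l) - (\<Union>m\<in>M. ?B m)" using that by auto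
    moreover have "finite ((\<Inter>l\<in>L. ?B l) - (\<Union>m\<in>M. ?B m))"
      by (rule finite_subset[of _ ?X]) (use \<open>L \<noteq> {}\<close> in auto)
    ultimately have "card ({L} \<times> {..<d}) \<le> card ((\<Inter>l\<in>L. ?B l) - (\<Union>m\<in>M. ?B m))"
      by (rule card_mono[rotated])
    then show ?thesis by simp
  qed
  then have "cover_free_family r w d (card ?X) t ?X ?B"
    unfolding cover_free_family_def by auto
  from cover_free_family_transfer[OF this r] show ?thesis by blast
qed

lemma d_biclique_cover_exists:
  assumes "pair_graph G"
  shows "\<exists>C. d_biclique_cover d (with_proj G) C"
proof -
  interpret pair_graph G by fact
  let ?E = "\<lambda>e. \<lparr>pverts = {fst e, snd e}, parcs = {e, (snd e, fst e)}\<rparr>"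
  define C where "C = (\<Sum>e\<in>#mset_set (parcs G). replicate_mset d (with_proj (?E e)))"
  have sub: "subgraph (with_proj (?E e)) (with_proj G)" if "e \<in> parcs G" for e
  proof -
    have "(snd e, fst e) \<in> parcs G" "fst e \<in> pverts G" "snd e \<in> pverts G"
      using that arcs_symmetric by auto
    then show ?thesis using that wf_digraph
      by (auto simp: subgraph_def compatible_def wf_digraph_def)
  qed
  have bic: "biclique (with_proj (?E e))" if "e \<in> parcs G" for e
  proof -
    have "fst e \<noteq> snd e" using that no_loops by auto
    moreover obtain a b where "e = (a, b)" by fastforce
    ultimately have "card {a} = 1 \<and> card {b} = 1 \<and> finite (pverts (?E e)) \<and>
        pverts (?E e) = {a} \<union> {b} \<and> {a} \<inter> {b} = {} \<and> parcs (?E e) = {a} \<times> {b} \<union> {b} \<times> {a}"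
      by auto
    then have "complete_bipartite_digraph 1 1 (with_proj (?E e))"
      unfolding complete_bipartite_digraph_pair_def by blast
    then show ?thesis unfolding biclique_def by blast
  qed
  have mem: "\<exists>e\<in>parcs G. H = with_proj (?E e)" if "H \<in># C" for H
    using that by (auto simp: C_def split: if_splits)
  have "size {#H \<in># C. e \<in> arcs H#} \<ge> d" if "e \<in> parcs G" for e
  proof -
    have "e \<in># mset_set (parcs G)" using that by simp
    then obtain A where A: "mset_set (parcs G) = add_mset e A" by (blast dest: multi_member_split)
    have "replicate_mset d (with_proj (?E e)) \<subseteq># C" unfolding C_def A by simp
    then have "{#H \<in># replicate_mset d (with_proj (?E e)). e \<in> arcs H#} \<subseteq># {#H \<in># C. e \<in> arcs H#}"
      by (rule multiset_filter_mono)
    then have "size {#H \<in># replicate_mset d (with_proj (?E e)). e \<in> arcs H#}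
        \<le> size {#H \<in># C. e \<in> arcs H#}" by (rule size_mset_mono)
    moreover have "{#H \<in># replicate_mset d (with_proj (?E e)). e \<in> arcs H#}
        = replicate_mset d (with_proj (?E e))" by (induction d) simp_all
    ultimately show ?thesis by simp
  qed
  then have "d_biclique_cover d (with_proj G) C"
    unfolding d_biclique_cover_def using mem sub bic by (metis with_proj_simps(2))
  then show ?thesis by blast
qed

lemma pair_graph_bi_intersection_graph: "pair_graph (bi_intersection_graph t r w)"
proof
  let ?V = "Inl ` {A. A \<subseteq> {1..t} \<and> card A = r} \<union> Inr ` {B. B \<subseteq> {1..t} \<and> card B = w}"
  have fin: "finite ?V" by auto
  then show "finite (pverts (bi_intersection_graph t r w))"
    by (simp add: bi_intersection_graph_def)
  have "parcs (bi_intersection_graph t r w) \<subseteq> ?V \<times> ?V"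
    by (auto simp: bi_intersection_graph_def)
  then show "finite (parcs (bi_intersection_graph t r w))"
    using fin by (meson finite_SigmaI finite_subset)
qed (auto simp: bi_intersection_graph_def symmetric_def arcs_ends_def arc_to_ends_def sym_def)

end

theory Submission
  imports Defs
begin

text \<open>
  The points of a cover-free family and the bicliques of a cover are two descriptions of the same
  data, namely subsets \<open>S\<close> of \<open>{1..t}\<close>. A point \<open>x\<close> determines its trace, the set of indices of the
  blocks that contain it. A subset \<open>S\<close> determines the biclique that joins every \<open>r\<close>-set inside
  \<open>S\<close> to every \<open>w\<close>-set disjoint from \<open>S\<close>. The point \<open>x\<close> lies in all blocks indexed by \<open>L\<close> and in
  no block indexed by \<open>M\<close> exactly when its trace contains \<open>L\<close> and misses \<open>M\<close>, that is, when the
  edge \<open>LM\<close> belongs to the biclique of the trace. Hence the two lower bounds by \<open>d\<close> are the same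
  condition.

  Not every biclique of \<open>bi_intersection_graph t r w\<close> arises from a subset, but every one is
  contained, as far as its edges go, in one that does: take for \<open>S\<close> the union \<open>biclique_support\<close> of
  all \<open>r\<close>-sets that have an edge in the biclique. A \<open>w\<close>-set that has an edge is adjacent to all these
  \<open>r\<close>-sets, hence disjoint from their union (\<open>biclique_arc_separates\<close>). So \<open>n\<close> points suffice for a
  family if and only if \<open>n\<close> bicliques suffice for a cover (\<open>cover_free_family_iff_cover\<close>), and the
  minima agree.
\<close>

lemma arcs_bi_intersection_graph_iff:
  "e \<in> arcs (with_proj (bi_intersection_graph t r w)) \<longleftrightarrow>
     (\<exists>L M. L \<subseteq> {1..t} \<and> M \<subseteq> {1..t} \<and> L \<inter> M = {} \<and> card L = r \<and> card M = w \<and>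
        (e = (Inl L, Inr M) \<or> e = (Inr M, Inl L)))"
  by (auto simp: bi_intersection_graph_def)

definition subset_biclique ::
    "nat \<Rightarrow> nat \<Rightarrow> nat \<Rightarrow> nat set \<Rightarrow> (nat set + nat set) pair_pre_digraph" where
  "subset_biclique t r w S =
     (let U = Inl ` {A. A \<subseteq> {1..t} \<inter> S \<and> card A = r};
          W = Inr ` {A. A \<subseteq> {1..t} - S \<and> card A = w}
      in \<lparr> pverts = U \<union> W, parcs = U \<times> W \<union> W \<times> U \<rparr>)"

lemma subset_biclique_arc_iff:
  "(Inl L, Inr M) \<in> parcs (subset_biclique t r w S) \<longleftrightarrow>
     L \<subseteq> {1..t} \<inter> S \<and> card L = r \<and> M \<subseteq> {1..t} - S \<and> card M = w"
  "(Inr M, Inl L) \<in> parcs (subset_biclique t r w S) \<longleftrightarrow>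
     L \<subseteq> {1..t} \<inter> S \<and> card L = r \<and> M \<subseteq> {1..t} - S \<and> card M = w"
  by (auto simp: subset_biclique_def Let_def)

lemma biclique_subset_biclique: "biclique (with_proj (subset_biclique t r w S))"
proof -
  let ?U = "Inl ` {A. A \<subseteq> {1..t} \<inter> S \<and> card A = r} :: (nat set + nat set) set"
  let ?W = "Inr ` {A. A \<subseteq> {1..t} - S \<and> card A = w} :: (nat set + nat set) set"
  have "finite ?U" "finite ?W"
    by (auto intro: finite_subset[of _ "Pow {1..t}"])
  then have "complete_bipartite_digraph (card ?U) (card ?W) (with_proj (subset_biclique t r w S))"
    unfolding complete_bipartite_digraph_pair_def subset_biclique_def Let_def
    by (intro conjI exI[of _ ?U] exI[of _ ?W]) auto
  then show ?thesis unfolding biclique_def by blast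
qed

lemma subgraph_subset_biclique:
  "subgraph (with_proj (subset_biclique t r w S)) (with_proj (bi_intersection_graph t r w))"
proof -
  let ?H = "subset_biclique t r w S" and ?G = "bi_intersection_graph t r w"
  have "pverts ?H \<subseteq> pverts ?G"
    unfolding subset_biclique_def bi_intersection_graph_def Let_def by fastforce
  moreover have "parcs ?H \<subseteq> parcs ?G"
  proof
    fix e assume "e \<in> parcs ?H"
    then obtain L M where "L \<subseteq> {1..t} \<inter> S" "card L = r" "M \<subseteq> {1..t} - S" "card M = w"
        "e = (Inl L, Inr M) \<or> e = (Inr M, Inl L)"
      unfolding subset_biclique_def Let_def by auto
    moreover from this have "L \<subseteq> {1..t}" "M \<subseteq> {1..t}" "L \<inter> M = {}" by blast+
    ultimately have "e \<in> arcs (with_proj ?G)"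
      unfolding arcs_bi_intersection_graph_iff by blast
    then show "e \<in> parcs ?G" by simp
  qed
  moreover have "wf_digraph (with_proj ?H)"
    by (auto simp: wf_digraph_def subset_biclique_def Let_def)
  moreover have "wf_digraph (with_proj ?G)"
    by (auto simp: wf_digraph_def bi_intersection_graph_def)
  ultimately show ?thesis by (auto simp: subgraph_def compatible_def)
qed

definition biclique_support ::
    "(nat set + nat set, (nat set + nat set) \<times> (nat set + nat set)) pre_digraph \<Rightarrow> nat set" where
  "biclique_support H = \<Union>{A. \<exists>B. (Inl A, Inr B) \<in> arcs H}"

text \<open>
  Given two edges \<open>LM\<close> and \<open>L'M'\<close> of the biclique, completeness makes \<open>L'M\<close> an edge as well, so
  that \<open>L'\<close> misses \<open>M\<close>. This needs \<open>L\<close> and \<open>L'\<close> on the same side of the bipartition of \<open>H\<close>, which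
  holds since otherwise \<open>LL'\<close> would be an edge between two \<open>r\<close>-sets.
\<close>

lemma biclique_arc_separates:
  assumes sub: "subgraph H (with_proj (bi_intersection_graph t r w))" and bic: "biclique H"
    and arc: "(Inl L, Inr M) \<in> arcs H"
  shows "L \<subseteq> biclique_support H" and "biclique_support H \<inter> M = {}"
proof -
  let ?G = "with_proj (bi_intersection_graph t r w)"
  obtain U V where "arcs_ends H = U \<times> V \<union> V \<times> U"
    using bic unfolding biclique_def complete_bipartite_digraph_def by blast
  moreover have "arcs_ends H = arcs H"
    using sub by (simp add: subgraph_def compatible_def arcs_ends_def arc_to_ends_def)
  ultimately have UV: "arcs H = U \<times> V \<union> V \<times> U" by simp
  have arcsG: "arcs H \<subseteq> arcs ?G" using sub by blast
  show "L \<subseteq> biclique_support H" using arc by (auto simp: biclique_support_def)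
  have "L' \<inter> M = {}" if "(Inl L', Inr M') \<in> arcs H" for L' M'
  proof -
    have "(Inl L, Inl L') \<notin> arcs H" using arcsG arcs_bi_intersection_graph_iff by blast
    with arc that UV have "(Inl L', Inr M) \<in> arcs H" by blast
    with arcsG have "(Inl L', Inr M) \<in> arcs ?G" by blast
    then show ?thesis unfolding arcs_bi_intersection_graph_iff by blast
  qed
  then show "biclique_support H \<inter> M = {}" unfolding biclique_support_def by blast
qed

text \<open>Counting indices instead of values respects multiplicities, so \<open>f\<close> need not be injective.\<close>

lemma size_filter_image_mset_set:
  assumes "finite X"
  shows "size {#y \<in># image_mset f (mset_set X). P y#} = card {x \<in> X. P (f x)}"
  using assms by (simp add: filter_mset_image_mset)

lemma cover_of_cover_free_family:
  assumes r: "0 < r" and cff: "cover_free_family r w d n t X B"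
  shows "\<exists>C. d_biclique_cover d (with_proj (bi_intersection_graph t r w)) C \<and> size C = n"
proof -
  define trace where "trace x = {i \<in> {1..t}. x \<in> B i}" for x
  define H where "H x = with_proj (subset_biclique t r w (trace x))" for x
  define C where "C = image_mset H (mset_set X)"
  have fin: "finite X" and n: "card X = n" and BX: "\<And>i. i \<in> {1..t} \<Longrightarrow> B i \<subseteq> X"
    and free: "\<And>L M. L \<subseteq> {1..t} \<Longrightarrow> M \<subseteq> {1..t} \<Longrightarrow> L \<inter> M = {} \<Longrightarrow> card L = r \<Longrightarrow> card M = w \<Longrightarrow>
        d \<le> card ((\<Inter>l\<in>L. B l) - (\<Union>m\<in>M. B m))"
    using cff by (auto simp: cover_free_family_def)
  have "d \<le> size {#K \<in># C. e \<in> arcs K#}"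
    if edge: "e \<in> arcs (with_proj (bi_intersection_graph t r w))" for e
  proof -
    obtain L M where L: "L \<subseteq> {1..t}" "card L = r" and M: "M \<subseteq> {1..t}" "card M = w"
      and disj: "L \<inter> M = {}" and e: "e = (Inl L, Inr M) \<or> e = (Inr M, Inl L)"
      using edge unfolding arcs_bi_intersection_graph_iff by blast
    have iff: "e \<in> arcs (H x) \<longleftrightarrow> L \<subseteq> trace x \<and> M \<inter> trace x = {}" for x
      using e L M by (auto simp: H_def subset_biclique_arc_iff)
    (* The empty intersection would be all of the type, so L must be nonempty. *)
    obtain l where "l \<in> L" using L(2) r by fastforce
    then have interX: "(\<Inter>l\<in>L. B l) \<subseteq> X" using L(1) BX by blast
    have memL: "L \<subseteq> trace x \<longleftrightarrow> x \<in> (\<Inter>l\<in>L. B l)" for x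
      using L(1) unfolding trace_def by blast
    have memM: "M \<inter> trace x = {} \<longleftrightarrow> x \<notin> (\<Union>m\<in>M. B m)" for x
      using M(1) unfolding trace_def by blast
    have "(\<Inter>l\<in>L. B l) - (\<Union>m\<in>M. B m) = {x \<in> X. e \<in> arcs (H x)}"
      unfolding iff memL memM using interX
      by (intro set_eqI) (simp only: Diff_iff mem_Collect_eq, meson subsetD)
    then show ?thesis
      using free[OF L(1) M(1) disj L(2) M(2)] fin
      unfolding C_def by (simp only: size_filter_image_mset_set)
  qed
  moreover have "\<forall>K\<in>#C. subgraph K (with_proj (bi_intersection_graph t r w)) \<and> biclique K"
    by (auto simp: C_def H_def biclique_subset_biclique subgraph_subset_biclique)
  ultimately have "d_biclique_cover d (with_proj (bi_intersection_graph t r w)) C"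
    unfolding d_biclique_cover_def by blast
  moreover have "size C = n" using n by (simp add: C_def)
  ultimately show ?thesis by blast
qed

lemma cover_free_family_of_cover:
  assumes r: "0 < r"
    and cover: "d_biclique_cover d (with_proj (bi_intersection_graph t r w)) C"
  shows "\<exists>(X :: nat set) B. cover_free_family r w d (size C) t X B"
proof -
  (* Equal bicliques must yield distinct points, so the points are positions in a list. *)
  obtain Hs where Hs: "mset Hs = C" by (metis ex_mset)
  define X where "X = {..<length Hs}"
  define B where "B i = {k \<in> X. i \<in> biclique_support (Hs ! k)}" for i
  have "C = image_mset (nth Hs) (mset_set X)"
    unfolding X_def lessThan_atLeast0
    by (metis Hs map_nth mset_map mset_upt)
  then have count: "size {#K \<in># C. P K#} = card {k \<in> X. P (Hs ! k)}" for P
    by (simp only: size_filter_image_mset_set X_def finite_lessThan)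
  have H: "subgraph (Hs ! k) (with_proj (bi_intersection_graph t r w))" "biclique (Hs ! k)"
    if "k \<in> X" for k
  proof -
    have "Hs ! k \<in># C" using that Hs by (auto simp: X_def)
    then show "subgraph (Hs ! k) (with_proj (bi_intersection_graph t r w))" "biclique (Hs ! k)"
      using cover by (auto simp: d_biclique_cover_def)
  qed
  have "d \<le> card ((\<Inter>l\<in>L. B l) - (\<Union>m\<in>M. B m))"
    if LM: "L \<subseteq> {1..t}" "M \<subseteq> {1..t}" "L \<inter> M = {}" "card L = r" "card M = w" for L M
  proof -
    let ?e = "(Inl L, Inr M) :: (nat set + nat set) \<times> (nat set + nat set)"
    have "?e \<in> arcs (with_proj (bi_intersection_graph t r w))"
      using LM unfolding arcs_bi_intersection_graph_iff by blast
    then have "d \<le> card {k \<in> X. ?e \<in> arcs (Hs ! k)}"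
      using cover unfolding d_biclique_cover_def count by blast
    also have "\<dots> \<le> card ((\<Inter>l\<in>L. B l) - (\<Union>m\<in>M. B m))"
    proof (rule card_mono)
      obtain l where "l \<in> L" using LM(4) r by fastforce
      moreover have "B l \<subseteq> X" by (auto simp: B_def)
      ultimately have "(\<Inter>l\<in>L. B l) - (\<Union>m\<in>M. B m) \<subseteq> X" by blast
      then show "finite ((\<Inter>l\<in>L. B l) - (\<Union>m\<in>M. B m))"
        by (rule finite_subset) (simp add: X_def)
      show "{k \<in> X. ?e \<in> arcs (Hs ! k)} \<subseteq> (\<Inter>l\<in>L. B l) - (\<Union>m\<in>M. B m)"
      proof
        fix k assume "k \<in> {k \<in> X. ?e \<in> arcs (Hs ! k)}"
        then have k: "k \<in> X" and arc: "?e \<in> arcs (Hs ! k)" by auto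
        show "k \<in> (\<Inter>l\<in>L. B l) - (\<Union>m\<in>M. B m)"
          using biclique_arc_separates[OF H[OF k] arc] k unfolding B_def by blast
      qed
    qed
    finally show ?thesis .
  qed
  moreover have "card X = size C" using Hs by (auto simp: X_def)
  moreover have "finite X" "\<forall>i\<in>{1..t}. B i \<subseteq> X" by (auto simp: X_def B_def)
  ultimately have "cover_free_family r w d (size C) t X B"
    unfolding cover_free_family_def by simp
  then show ?thesis by blast
qed

lemma cover_free_family_iff_cover:
  assumes "0 < r"
  shows "(\<exists>(X :: nat set) B. cover_free_family r w d n t X B) \<longleftrightarrow>
    (\<exists>C. d_biclique_cover d (with_proj (bi_intersection_graph t r w)) C \<and> size C = n)"
  using cover_of_cover_free_family[OF assms] cover_free_family_of_cover[OF assms] by metis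

theorem corollary1:
  fixes r w d t :: nat
  assumes "0 < r" and "0 < w" and "0 < d" and "0 < t"
    and "w \<le> r" and "r + w \<le> t"
  shows "cff_number r w d t =
    biclique_cover_number d (with_proj (bi_intersection_graph t r w))"
  unfolding cff_number_def biclique_cover_number_def
  by (simp only: cover_free_family_iff_cover[OF \<open>0 < r\<close>])

end
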